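(* For every closed $\lambda$-term $M$ there exists a closed term $N$ in weak $\beta\mathbf{\Omega}$ head normal form such that $M \longrightarrow^{*}_{w\beta\Omega} N$.
   Context: Untyped $\lambda$-calculus; $[N/x]U$ is capture-avoiding substitution; $\mathbf{\Omega}\equiv(\lambda x.xx)(\lambda x.xx)$; a closed term is unsolvable if no application of it to closed terms $\beta$-converts to $\lambda x.x$, solvable otherwise. Weak $\beta\mathbf{\Omega}$-reduction $\longrightarrow_{w\beta\Omega}$ is the closure under contexts of the contraction rules $(\lambda x.M)N \to [N/x]M$ (only when the redex $(\lambda x.M)N$ is closed) and $M\to\mathbf{\Omega}$ (only when $M$ is closed, unsolvable and $M\not\equiv\mathbf{\Omega}$); $\longrightarrow^{*}_{w\beta\Omega}$ is its reflexive transitive closure. A closed term is in weak $\beta\mathbf{\Omega}$ head normal form (whnf) if either it is unsolvable and is $\mathbf{\Omega}$, or it is solvable and is not of the form $\lambda x_1\dots x_n.(\lambda x.U)VM_1\cdots M_k$ with $\lambda x.U$ and $V$ closed. *)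

theory Defs
  imports Main
begin

text \<open>
  Untyped \<open>\<lambda>\<close>-terms up to \<open>\<alpha>\<close>-conversion are represented with de Bruijn indices, so
  syntactic identity is plain equality.
\<close>

datatype trm = Var nat | App trm trm | Lam trm

primrec free_vars :: "trm \<Rightarrow> nat set" where
  "free_vars (Var i) = {i}"
| "free_vars (App s t) = free_vars s \<union> free_vars t"
| "free_vars (Lam t) = {i. Suc i \<in> free_vars t}"

definition closed_trm :: "trm \<Rightarrow> bool" where
  "closed_trm t \<longleftrightarrow> free_vars t = {}"

primrec lift :: "trm \<Rightarrow> nat \<Rightarrow> trm" where
  "lift (Var i) k = (if i < k then Var i else Var (Suc i))"
| "lift (App s t) k = App (lift s k) (lift t k)"
| "lift (Lam t) k = Lam (lift t (Suc k))"

text \<open>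
  \<open>subst t s k\<close> replaces index \<open>k\<close> by \<open>s\<close> in \<open>t\<close> and lowers the indices above \<open>k\<close>, since
  the binder of \<open>k\<close> disappears in a contraction; \<open>subst t s 0\<close> is \<open>[s/x]t\<close> in the
  contractum of \<open>(\<lambda>x. t) s\<close>.
\<close>

primrec subst :: "trm \<Rightarrow> trm \<Rightarrow> nat \<Rightarrow> trm" where
  "subst (Var i) s k = (if k < i then Var (i - 1) else if i = k then s else Var i)"
| "subst (App t u) s k = App (subst t s k) (subst u s k)"
| "subst (Lam t) s k = Lam (subst t (lift s 0) (Suc k))"

definition Omega :: trm where
  "Omega = App (Lam (App (Var 0) (Var 0))) (Lam (App (Var 0) (Var 0)))"

inductive ctxt_closure :: "(trm \<Rightarrow> trm \<Rightarrow> bool) \<Rightarrow> trm \<Rightarrow> trm \<Rightarrow> bool"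
  for R :: "trm \<Rightarrow> trm \<Rightarrow> bool" where
  base: "R s t \<Longrightarrow> ctxt_closure R s t"
| appL: "ctxt_closure R s t \<Longrightarrow> ctxt_closure R (App s u) (App t u)"
| appR: "ctxt_closure R s t \<Longrightarrow> ctxt_closure R (App u s) (App u t)"
| lam: "ctxt_closure R s t \<Longrightarrow> ctxt_closure R (Lam s) (Lam t)"

inductive beta_contr :: "trm \<Rightarrow> trm \<Rightarrow> bool" where
  "beta_contr (App (Lam t) s) (subst t s 0)"

definition beta_conv :: "trm \<Rightarrow> trm \<Rightarrow> bool" where
  "beta_conv = equivclp (ctxt_closure beta_contr)"

definition apps :: "trm \<Rightarrow> trm list \<Rightarrow> trm" where
  "apps t ts = foldl App t ts"

definition unsolvable :: "trm \<Rightarrow> bool" where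
  "unsolvable t \<longleftrightarrow> closed_trm t \<and>
     \<not> (\<exists>ts. (\<forall>u \<in> set ts. closed_trm u) \<and> beta_conv (apps t ts) (Lam (Var 0)))"

definition solvable :: "trm \<Rightarrow> bool" where
  "solvable t \<longleftrightarrow> closed_trm t \<and> \<not> unsolvable t"

text \<open>
  A subterm occurrence below binders is closed iff its de Bruijn term has no free index, and
  closed terms are unaffected by lifting. So the rules need no index adjustment when they are
  applied under binders.
\<close>

inductive wbO_contr :: "trm \<Rightarrow> trm \<Rightarrow> bool" where
  wbeta: "closed_trm (App (Lam t) s) \<Longrightarrow> wbO_contr (App (Lam t) s) (subst t s 0)"
| omega: "closed_trm t \<Longrightarrow> unsolvable t \<Longrightarrow> t \<noteq> Omega \<Longrightarrow> wbO_contr t Omega"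

definition wbO :: "trm \<Rightarrow> trm \<Rightarrow> bool" where
  "wbO = ctxt_closure wbO_contr"

definition whnf :: "trm \<Rightarrow> bool" where
  "whnf t \<longleftrightarrow> closed_trm t \<and>
     (unsolvable t \<and> t = Omega \<or>
      solvable t \<and>
      \<not> (\<exists>n U V Ms. closed_trm (Lam U) \<and> closed_trm V \<and>
           t = (Lam ^^ n) (apps (App (Lam U) V) Ms)))"

end

theory Submission imports Defs begin

text \<open>
  An unsolvable term reduces to \<open>\<Omega>\<close> in at most one step. The redex that keeps a
  solvable term from being in weak head normal form is its head redex, so it suffices that head
  reduction of solvable terms terminates. This is read off a graph model: a solvable term has a
  nonempty interpretation, because the interpretation is invariant under conversion, that of the
  identity is nonempty, and application is strict in the function. Conversely, every point of the
  interpretation of a term is realized by that term in a reducibility relation whose base case is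
  termination of head reduction. In particular \<open>\<Omega>\<close>, which head-reduces to itself, is unsolvable.
\<close>

section \<open>Parallel substitution\<close>

primrec ren :: "(nat \<Rightarrow> nat) \<Rightarrow> trm \<Rightarrow> trm" where
  "ren f (Var i) = Var (f i)"
| "ren f (App s t) = App (ren f s) (ren f t)"
| "ren f (Lam t) = Lam (ren (case_nat 0 (\<lambda>i. Suc (f i))) t)"

definition up :: "(nat \<Rightarrow> trm) \<Rightarrow> nat \<Rightarrow> trm" where
  "up \<sigma> = case_nat (Var 0) (\<lambda>i. ren Suc (\<sigma> i))"

text \<open>Substituting for all variables at once makes composition pointwise, without index
  arithmetic, and lets the reducibility argument carry a whole environment of realizers.\<close>

primrec psubst :: "(nat \<Rightarrow> trm) \<Rightarrow> trm \<Rightarrow> trm" where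
  "psubst \<sigma> (Var i) = \<sigma> i"
| "psubst \<sigma> (App s t) = App (psubst \<sigma> s) (psubst \<sigma> t)"
| "psubst \<sigma> (Lam t) = Lam (psubst (up \<sigma>) t)"

lemma up_simps [simp]: "up \<sigma> 0 = Var 0" "up \<sigma> (Suc i) = ren Suc (\<sigma> i)"
  by (simp_all add: up_def)

lemma ren_ren: "ren f (ren g t) = ren (\<lambda>i. f (g i)) t"
proof (induction t arbitrary: f g)
  case (Lam t)
  have "(\<lambda>i. case_nat 0 (\<lambda>i. Suc (f i)) (case_nat 0 (\<lambda>i. Suc (g i)) i))
      = case_nat 0 (\<lambda>i. Suc (f (g i)))"
    by (auto split: nat.splits)
  then show ?case by (simp add: Lam)
qed auto

lemma psubst_ren: "psubst \<sigma> (ren f t) = psubst (\<lambda>i. \<sigma> (f i)) t"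
proof (induction t arbitrary: f \<sigma>)
  case (Lam t)
  have "(\<lambda>i. up \<sigma> (case_nat 0 (\<lambda>i. Suc (f i)) i)) = up (\<lambda>i. \<sigma> (f i))"
    by (auto simp: up_def split: nat.splits)
  then show ?case by (simp add: Lam)
qed auto

lemma ren_psubst: "ren f (psubst \<sigma> t) = psubst (\<lambda>i. ren f (\<sigma> i)) t"
proof (induction t arbitrary: f \<sigma>)
  case (Lam t)
  have "(\<lambda>i. ren (case_nat 0 (\<lambda>i. Suc (f i))) (up \<sigma> i)) = up (\<lambda>i. ren f (\<sigma> i))"
    by (auto simp: up_def ren_ren split: nat.splits)
  then show ?case by (simp add: Lam)
qed auto

text \<open>Under a binder this rests on the commutations \<open>psubst_ren\<close> and
  \<open>ren_psubst\<close>, the latter of which rests on \<open>ren_ren\<close>.\<close>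

lemma psubst_psubst: "psubst \<sigma> (psubst \<tau> t) = psubst (\<lambda>i. psubst \<sigma> (\<tau> i)) t"
proof (induction t arbitrary: \<sigma> \<tau>)
  case (Lam t)
  have "(\<lambda>i. psubst (up \<sigma>) (up \<tau> i)) = up (\<lambda>i. psubst \<sigma> (\<tau> i))"
    by (auto simp: up_def psubst_ren ren_psubst split: nat.splits)
  then show ?case by (simp add: Lam)
qed auto

lemma psubst_Var: "psubst Var t = t"
proof (induction t)
  case (Lam t)
  have "up Var = Var" by (auto simp: up_def split: nat.splits)
  then show ?case by (simp add: Lam)
qed auto

lemma lift_eq_ren: "lift t k = ren (\<lambda>i. if i < k then i else Suc i) t"
proof (induction t arbitrary: k)
  case (Lam t)
  have "case_nat 0 (\<lambda>i. Suc (if i < k then i else Suc i)) = (\<lambda>i. if i < Suc k then i else Suc i)"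
    by (auto split: nat.splits)
  then show ?case by (simp add: Lam)
qed auto

lemma subst_eq_psubst:
  "subst t s k = psubst (\<lambda>i. if k < i then Var (i - 1) else if i = k then s else Var i) t"
proof (induction t arbitrary: s k)
  case (Lam t)
  have "up (\<lambda>i. if k < i then Var (i - 1) else if i = k then s else Var i)
      = (\<lambda>i. if Suc k < i then Var (i - 1) else if i = Suc k then lift s 0 else Var i)"
    by (auto simp: up_def lift_eq_ren split: nat.splits)
  then show ?case by (simp add: Lam)
qed auto

lemma subst_0_eq_psubst: "subst t s 0 = psubst (case_nat s Var) t"
  unfolding subst_eq_psubst
  by (rule arg_cong[where f = "\<lambda>\<sigma>. psubst \<sigma> t"]) (auto split: nat.splits)

lemma subst_psubst_up: "subst (psubst (up \<sigma>) t) u 0 = psubst (case_nat u \<sigma>) t"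
proof -
  have "(\<lambda>i. psubst (case_nat u Var) (up \<sigma> i)) = case_nat u \<sigma>"
    by (auto simp: up_def psubst_ren psubst_Var split: nat.splits)
  then show ?thesis by (simp add: subst_0_eq_psubst psubst_psubst)
qed

lemma psubst_subst: "psubst \<sigma> (subst t s 0) = subst (psubst (up \<sigma>) t) (psubst \<sigma> s) 0"
proof -
  have "(\<lambda>i. psubst \<sigma> (case_nat s Var i)) = case_nat (psubst \<sigma> s) \<sigma>"
    by (auto split: nat.splits)
  then show ?thesis by (simp add: subst_psubst_up) (simp add: subst_0_eq_psubst psubst_psubst)
qed

section \<open>Head reduction\<close>

text \<open>The side condition of \<open>app\<close> gives a redex priority over steps inside its
  function part, so at most one step is possible from any term.\<close>

inductive head_red :: "trm \<Rightarrow> trm \<Rightarrow> bool" where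
  beta: "head_red (App (Lam t) s) (subst t s 0)"
| app: "head_red s s' \<Longrightarrow> \<forall>r. s \<noteq> Lam r \<Longrightarrow> head_red (App s u) (App s' u)"
| lam: "head_red t t' \<Longrightarrow> head_red (Lam t) (Lam t')"

inductive_cases head_red_VarE: "head_red (Var i) t"
inductive_cases head_red_AppE: "head_red (App s u) t"
inductive_cases head_red_LamE: "head_red (Lam s) t"

lemma head_red_deterministic: "head_red s t \<Longrightarrow> head_red s t' \<Longrightarrow> t = t'"
  by (induction arbitrary: t' rule: head_red.induct)
    (blast elim: head_red_AppE head_red_LamE)+

lemma head_red_psubst: "head_red s t \<Longrightarrow> head_red (psubst \<sigma> s) (psubst \<sigma> t)"
proof (induction arbitrary: \<sigma> rule: head_red.induct)
  case (beta t s)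
  then show ?case by (simp add: psubst_subst head_red.beta)
next
  case (app s s' u)
  \<comment> \<open>A term with a head step is not a variable, and \<open>s\<close> is not an
    abstraction. An application stays one under substitution, so the side condition
    survives.\<close>
  then obtain s1 s2 where "s = App s1 s2"
    by (cases s) (auto elim: head_red_VarE)
  with app show ?case by (auto intro: head_red.app)
next
  case (lam t t')
  then show ?case by (auto intro: head_red.lam)
qed

abbreviation head_terminating :: "trm \<Rightarrow> bool" where
  "head_terminating \<equiv> Wellfounded.accp (\<lambda>t s. head_red s t)"

lemma head_terminating_expand: "head_red s t \<Longrightarrow> head_terminating t \<Longrightarrow> head_terminating s"
  by (metis accp.accI head_red_deterministic)

text \<open>Every head step of \<open>t\<close> is mirrored by one of its instance.\<close>

lemma head_terminating_psubst:
  assumes "head_terminating (psubst \<sigma> t)"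
  shows "head_terminating t"
  using assms
proof (induction "psubst \<sigma> t" arbitrary: t rule: accp.induct)
  case (accI t)
  then show ?case by (metis accp.accI head_red_psubst)
qed

text \<open>Head steps of \<open>s\<close> are head steps of \<open>App s u\<close> until an
  abstraction \<open>Lam r\<close> appears. Then the contractum is an instance of \<open>r\<close>,
  so \<open>r\<close> terminates by \<open>head_terminating_psubst\<close>.\<close>

lemma head_terminating_App:
  assumes "head_terminating (App s u)"
  shows "head_terminating s"
  using assms
proof (induction "App s u" arbitrary: s rule: accp.induct)
  case (accI s)
  show ?case
  proof (cases "\<exists>r. s = Lam r")
    case True
    then obtain r where r: "s = Lam r" ..
    have "head_terminating (psubst (case_nat u Var) r)"
      using accI(1) head_red.beta[of r u] by (simp add: r subst_0_eq_psubst)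
    then have "head_terminating r" by (rule head_terminating_psubst)
    then have "head_terminating (Lam r)"
    proof (induction r rule: accp.induct)
      case (accI r)
      show ?case by (rule accp.accI) (auto elim: head_red_LamE intro: accI(2))
    qed
    with r show ?thesis by simp
  next
    case False
    show ?thesis
    proof (rule accp.accI)
      fix s' assume "head_red s s'"
      then have "head_red (App s u) (App s' u)" using False by (intro head_red.app) auto
      then show "head_terminating s'" by (rule accI(2))
    qed
  qed
qed

section \<open>A graph model\<close>

text \<open>Engeler's graph model over one atom, with lists in place of finite sets.
  \<open>Arr as b\<close> is an entry of a function graph: the inputs \<open>as\<close> suffice for
  the output \<open>b\<close>. It can also be read as an intersection type.\<close>

datatype point = Base | Arr "point list" point

primrec sem :: "trm \<Rightarrow> (nat \<Rightarrow> point set) \<Rightarrow> point set" where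
  "sem (Var i) \<rho> = \<rho> i"
| "sem (App s t) \<rho> = {b. \<exists>as. set as \<subseteq> sem t \<rho> \<and> Arr as b \<in> sem s \<rho>}"
| "sem (Lam t) \<rho> = {Arr as b | as b. b \<in> sem t (case_nat (set as) \<rho>)}"

lemma sem_ren: "sem (ren f t) \<rho> = sem t (\<lambda>i. \<rho> (f i))"
proof (induction t arbitrary: f \<rho>)
  case (Lam t)
  have "(\<lambda>i. case_nat X \<rho> (case_nat 0 (\<lambda>i. Suc (f i)) i)) = case_nat X (\<lambda>i. \<rho> (f i))" for X
    by (auto split: nat.splits)
  then show ?case by (simp add: Lam)
qed auto

lemma sem_psubst: "sem (psubst \<sigma> t) \<rho> = sem t (\<lambda>i. sem (\<sigma> i) \<rho>)"
proof (induction t arbitrary: \<sigma> \<rho>)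
  case (Lam t)
  have "(\<lambda>i. sem (up \<sigma> i) (case_nat X \<rho>)) = case_nat X (\<lambda>i. sem (\<sigma> i) \<rho>)" for X
    by (auto simp: up_def sem_ren split: nat.splits)
  then show ?case by (simp add: Lam)
qed auto

lemma sem_mono: "(\<And>i. \<rho> i \<subseteq> \<rho>' i) \<Longrightarrow> sem t \<rho> \<subseteq> sem t \<rho>'"
proof (induction t arbitrary: \<rho> \<rho>')
  case (Lam t)
  have "sem t (case_nat X \<rho>) \<subseteq> sem t (case_nat X \<rho>')" for X
    by (rule Lam.IH) (auto simp: Lam.prems split: nat.splits)
  then show ?case by fastforce
next
  case (App s t)
  then show ?case by simp blast
qed auto

text \<open>Continuity in all variables at once; lists of points are the finite approximations.\<close>

lemma sem_finite_approx:
  "b \<in> sem t \<rho> \<Longrightarrow> \<exists>F. (\<forall>i. set (F i) \<subseteq> \<rho> i) \<and> b \<in> sem t (\<lambda>i. set (F i))"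
proof (induction t arbitrary: b \<rho>)
  case (Var j)
  then show ?case by (intro exI[of _ "\<lambda>i. if i = j then [b] else []"]) auto
next
  case (Lam t)
  then obtain as c where b: "b = Arr as c" and c: "c \<in> sem t (case_nat (set as) \<rho>)"
    by auto
  from Lam.IH[OF c] obtain F where F: "\<And>i. set (F i) \<subseteq> case_nat (set as) \<rho> i"
    and cF: "c \<in> sem t (\<lambda>i. set (F i))" by blast
  \<comment> \<open>The approximation of the bound variable lies within \<open>as\<close> and may be
    enlarged to it; those of the other variables are shifted down by one.\<close>
  have "sem t (\<lambda>i. set (F i)) \<subseteq> sem t (case_nat (set as) (\<lambda>i. set (F (Suc i))))"
    by (rule sem_mono) (use F[of 0] in \<open>auto split: nat.splits\<close>)
  with cF b F[of "Suc _"] show ?case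
    by (intro exI[of _ "\<lambda>i. F (Suc i)"]) auto
next
  case (App s t)
  then obtain as where as: "set as \<subseteq> sem t \<rho>" and s: "Arr as b \<in> sem s \<rho>" by auto
  from App.IH(1)[OF s] obtain F where F: "\<And>i. set (F i) \<subseteq> \<rho> i"
    and sF: "Arr as b \<in> sem s (\<lambda>i. set (F i))" by blast
  \<comment> \<open>Each of the finitely many points of \<open>as\<close> has its own approximation;
    appending these lists gives a common one.\<close>
  from as have "\<exists>G. (\<forall>i. set (G i) \<subseteq> \<rho> i) \<and> set as \<subseteq> sem t (\<lambda>i. set (G i))"
  proof (induction as)
    case Nil
    show ?case by (intro exI[of _ "\<lambda>_. []"]) auto
  next
    case (Cons a as)
    then obtain G where G: "\<And>i. set (G i) \<subseteq> \<rho> i" "set as \<subseteq> sem t (\<lambda>i. set (G i))" by auto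
    from Cons.prems App.IH(2)[of a \<rho>] obtain H
      where H: "\<And>i. set (H i) \<subseteq> \<rho> i" "a \<in> sem t (\<lambda>i. set (H i))" by auto
    have "sem t (\<lambda>i. set (G i)) \<union> sem t (\<lambda>i. set (H i)) \<subseteq> sem t (\<lambda>i. set (G i @ H i))"
      by (intro Un_least sem_mono) auto
    with G H show ?case by (intro exI[of _ "\<lambda>i. G i @ H i"]) auto
  qed
  then obtain G where G: "\<And>i. set (G i) \<subseteq> \<rho> i" "set as \<subseteq> sem t (\<lambda>i. set (G i))" by blast
  have "sem t (\<lambda>i. set (G i)) \<subseteq> sem t (\<lambda>i. set (F i @ G i))"
    and "sem s (\<lambda>i. set (F i)) \<subseteq> sem s (\<lambda>i. set (F i @ G i))"
    by (intro sem_mono; auto)+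
  with G(2) sF have "set as \<subseteq> sem t (\<lambda>i. set (F i @ G i))"
    and "Arr as b \<in> sem s (\<lambda>i. set (F i @ G i))" by blast+
  then have "b \<in> sem (App s t) (\<lambda>i. set (F i @ G i))" unfolding sem.simps by blast
  with F G(1) show ?case by (intro exI[of _ "\<lambda>i. F i @ G i"]) auto
qed

text \<open>A point of the contractum uses only finitely many points of the argument, by continuity:
  the approximation \<open>F 0\<close> of the bound variable provides the list \<open>as\<close>.
  The converse inclusion is monotonicity.\<close>

lemma sem_beta: "sem (App (Lam t) s) \<rho> = sem (subst t s 0) \<rho>"
proof -
  have env: "(\<lambda>i. sem (case_nat s Var i) \<rho>) = case_nat (sem s \<rho>) \<rho>"
    by (auto split: nat.splits)
  have "b \<in> sem t (case_nat (sem s \<rho>) \<rho>) \<longleftrightarrow>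
      (\<exists>as. set as \<subseteq> sem s \<rho> \<and> b \<in> sem t (case_nat (set as) \<rho>))" (is "?L \<longleftrightarrow> ?R") for b
  proof
    assume ?L
    then obtain F where F: "\<And>i. set (F i) \<subseteq> case_nat (sem s \<rho>) \<rho> i"
      and b: "b \<in> sem t (\<lambda>i. set (F i))" using sem_finite_approx by blast
    have "sem t (\<lambda>i. set (F i)) \<subseteq> sem t (case_nat (set (F 0)) \<rho>)"
      by (rule sem_mono) (use F[of "Suc _"] in \<open>auto split: nat.splits\<close>)
    with b F[of 0] show ?R by auto
  next
    assume ?R
    then obtain as where as: "set as \<subseteq> sem s \<rho>" "b \<in> sem t (case_nat (set as) \<rho>)" by blast
    have "sem t (case_nat (set as) \<rho>) \<subseteq> sem t (case_nat (sem s \<rho>) \<rho>)"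
      by (rule sem_mono) (use as in \<open>auto split: nat.splits\<close>)
    with as show ?L by blast
  qed
  then show ?thesis by (auto simp: subst_0_eq_psubst sem_psubst env)
qed

lemma sem_beta_conv:
  assumes "beta_conv s t"
  shows "sem s = sem t"
proof -
  have step: "sem s = sem t" if "ctxt_closure beta_contr s t" for s t
    using that
  proof induction
    case (base s t)
    then show ?case using sem_beta by (auto elim!: beta_contr.cases simp del: sem.simps)
  qed (auto simp: fun_eq_iff)
  from assms show ?thesis
    unfolding beta_conv_def by (induction rule: equivclp_induct) (auto dest: step)
qed

lemma apps_simps [simp]: "apps t [] = t" "apps t (u # us) = apps (App t u) us"
  by (simp_all add: apps_def)

lemma sem_apps_nonempty: "sem (apps t us) \<rho> \<noteq> {} \<Longrightarrow> sem t \<rho> \<noteq> {}"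
proof (induction us arbitrary: t)
  case (Cons u us)
  then have "sem (App t u) \<rho> \<noteq> {}" unfolding apps_simps by blast
  then show ?case by auto
qed simp

section \<open>Reducibility\<close>

text \<open>A logical predicate over points read as types. The argument \<open>u\<close> ranges over
  open terms too, so that variables can serve as test arguments.\<close>

fun realizes :: "trm \<Rightarrow> point \<Rightarrow> bool" where
  "realizes t Base \<longleftrightarrow> head_terminating t"
| "realizes t (Arr as b) \<longleftrightarrow> (\<forall>u. (\<forall>a\<in>set as. realizes u a) \<longrightarrow> realizes (App t u) b)"

text \<open>At an arrow the step must remain a head step in front of an argument, hence the side
  condition. It holds again for \<open>App s u\<close>, which is no abstraction.\<close>

lemma realizes_expand:
  "head_red s t \<Longrightarrow> \<forall>r. s \<noteq> Lam r \<Longrightarrow> realizes t b \<Longrightarrow> realizes s b"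
proof (induction b arbitrary: s t)
  case Base
  then show ?case by (auto intro: head_terminating_expand)
next
  case (Arr as b)
  have "realizes (App s u) b" if "\<forall>a\<in>set as. realizes u a" for u
  proof (rule Arr.IH(2))
    show "head_red (App s u) (App t u)" using Arr.prems by (intro head_red.app)
    show "realizes (App t u) b" using Arr.prems that by simp
  qed simp
  then show ?case by simp
qed

text \<open>A variable applied to arguments: it has no head step, and further arguments do not
  create one.\<close>

inductive neutral :: "trm \<Rightarrow> bool" where
  "neutral (Var i)"
| "neutral s \<Longrightarrow> neutral (App s t)"

lemma neutral_no_head_red: "neutral s \<Longrightarrow> \<not> head_red s t"
  by (induction arbitrary: t rule: neutral.induct)
    (auto elim!: head_red_VarE head_red_AppE elim: neutral.cases)

lemma neutral_realizes: "neutral t \<Longrightarrow> realizes t b"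
proof (induction b arbitrary: t)
  case Base
  then show ?case by (auto intro: accp.accI dest: neutral_no_head_red)
next
  case (Arr as b)
  then show ?case by (auto intro: neutral.intros)
qed

text \<open>At an arrow, \<open>Var 0\<close> is a legitimate argument because neutral terms realize
  every point; \<open>head_terminating_App\<close> then removes it.\<close>

lemma realizes_head_terminating: "realizes t b \<Longrightarrow> head_terminating t"
proof (induction b arbitrary: t)
  case (Arr as b)
  have "realizes (App t (Var 0)) b"
    using Arr.prems neutral_realizes by (auto intro: neutral.intros)
  then show ?case using Arr.IH(2) head_terminating_App by blast
qed simp

text \<open>The fundamental lemma of the logical predicate. For an abstraction, the applied term
  head-reduces to the body in the environment extended by the argument, and
  \<open>realizes_expand\<close> goes back.\<close>

lemma sem_realizes:
  "\<forall>i. \<forall>a\<in>\<rho> i. realizes (\<sigma> i) a \<Longrightarrow> b \<in> sem t \<rho> \<Longrightarrow> realizes (psubst \<sigma> t) b"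
proof (induction t arbitrary: \<rho> \<sigma> b)
  case (App s t)
  from App.prems(2) obtain as where as: "set as \<subseteq> sem t \<rho>" and s: "Arr as b \<in> sem s \<rho>"
    by auto
  from as have "\<forall>a\<in>set as. realizes (psubst \<sigma> t) a"
    using App.IH(2)[OF App.prems(1)] by blast
  with App.IH(1)[OF App.prems(1) s] show ?case by simp
next
  case (Lam t)
  then obtain as c where b: "b = Arr as c" and c: "c \<in> sem t (case_nat (set as) \<rho>)"
    by auto
  have "realizes (App (Lam (psubst (up \<sigma>) t)) u) c" if "\<forall>a\<in>set as. realizes u a" for u
  proof (rule realizes_expand[OF head_red.beta])
    show "realizes (subst (psubst (up \<sigma>) t) u 0) c"
      unfolding subst_psubst_up
      by (rule Lam.IH[OF _ c]) (use that Lam.prems(1) in \<open>auto split: nat.splits\<close>)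
  qed simp
  with b show ?case by simp
qed simp

lemma sem_nonempty_head_terminating:
  assumes "sem t \<rho> \<noteq> {}"
  shows "head_terminating t"
proof -
  from assms obtain b where "b \<in> sem t \<rho>" by blast
  \<comment> \<open>A neutral term realizes every point, so a constant substitution by
    \<open>Var 0\<close> fits any environment \<open>\<rho>\<close>.\<close>
  then have "realizes (psubst (\<lambda>_. Var 0) t) b"
    by (rule sem_realizes[rotated]) (auto intro: neutral_realizes neutral.intros)
  then show ?thesis using realizes_head_terminating head_terminating_psubst by blast
qed

lemma solvable_head_terminating:
  assumes "solvable t"
  shows "head_terminating t"
proof -
  from assms obtain us where "beta_conv (apps t us) (Lam (Var 0))"
    unfolding solvable_def unsolvable_def by blast
  then have "sem (apps t us) (\<lambda>_. {}) = sem (Lam (Var 0)) (\<lambda>_. {})"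
    by (simp only: sem_beta_conv)
  moreover have "Arr [Base] Base \<in> sem (Lam (Var 0)) (\<lambda>_. {})" by simp
  ultimately have "sem (apps t us) (\<lambda>_. {}) \<noteq> {}" by blast
  then show ?thesis using sem_apps_nonempty sem_nonempty_head_terminating by blast
qed

lemma unsolvable_Omega: "unsolvable Omega"
proof (rule ccontr)
  have "closed_trm Omega" by (simp add: closed_trm_def Omega_def)
  moreover assume "\<not> unsolvable Omega"
  ultimately have "head_terminating Omega"
    by (simp add: solvable_def solvable_head_terminating)
  moreover have "head_red Omega Omega"
    using head_red.beta[of "App (Var 0) (Var 0)"] by (simp add: Omega_def)
  ultimately show False
    by (induction Omega rule: accp.induct) blast
qed

section \<open>Weak head reduction\<close>

lemma lift_id: "free_vars t \<subseteq> {..<k} \<Longrightarrow> lift t k = t"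
proof (induction t arbitrary: k)
  case (Lam t)
  have "free_vars t \<subseteq> {..<Suc k}"
  proof
    fix i assume "i \<in> free_vars t"
    with Lam.prems show "i \<in> {..<Suc k}" by (cases i) auto
  qed
  with Lam.IH show ?case by simp
qed auto

text \<open>A closed \<open>s\<close> contributes no index, and indices above \<open>k\<close> drop
  by one; so an index \<open>i\<close> at or above \<open>k\<close> in the result was
  \<open>Suc i\<close> before.\<close>

lemma free_vars_subst_closed:
  assumes "closed_trm s"
  shows "free_vars (subst t s k) \<subseteq> {i. if i < k then i \<in> free_vars t else Suc i \<in> free_vars t}"
proof (induction t arbitrary: k)
  case (Var i)
  then show ?case using assms by (auto simp: closed_trm_def)
next
  case (App t u)
  then show ?case by (fastforce split: if_splits)
next
  case (Lam t)
  have "lift s 0 = s" using assms by (simp add: closed_trm_def lift_id)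
  with Lam[of "Suc k"] show ?case by (fastforce split: if_splits)
qed

lemma closed_trm_subst:
  assumes "closed_trm (Lam t)" "closed_trm s"
  shows "closed_trm (subst t s 0)"
  using assms free_vars_subst_closed[OF assms(2), of t 0] by (auto simp: closed_trm_def)

text \<open>An inclusion, rather than preservation of closedness, passes through the induction under
  binders, where subterms may be open.\<close>

lemma wbO_free_vars: "wbO s t \<Longrightarrow> free_vars t \<subseteq> free_vars s"
  unfolding wbO_def
proof (induction rule: ctxt_closure.induct)
  case (base s t)
  then show ?case
  proof cases
    case (wbeta r u)
    then have "closed_trm (Lam r)" "closed_trm u" by (simp_all add: closed_trm_def)
    with wbeta have "closed_trm t" by (simp add: closed_trm_subst)
    then show ?thesis by (simp add: closed_trm_def)
  qed (auto simp: Omega_def)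
qed auto

section \<open>Contracting the head redex of a solvable term\<close>

lemma ctxt_closure_apps: "ctxt_closure R s t \<Longrightarrow> ctxt_closure R (apps s us) (apps t us)"
  by (induction us arbitrary: s t) (auto intro: ctxt_closure.appL)

lemma ctxt_closure_Lams: "ctxt_closure R s t \<Longrightarrow> ctxt_closure R ((Lam ^^ n) s) ((Lam ^^ n) t)"
  by (induction n) (auto intro: ctxt_closure.lam)

lemma head_red_apps:
  "head_red s t \<Longrightarrow> \<forall>r. s \<noteq> Lam r \<Longrightarrow> head_red (apps s us) (apps t us)"
  by (induction us arbitrary: s t) (auto intro: head_red.app)

lemma head_red_Lams: "head_red s t \<Longrightarrow> head_red ((Lam ^^ n) s) ((Lam ^^ n) t)"
  by (induction n) (auto intro: head_red.lam)

text \<open>The arguments that bring \<open>s\<close> to the identity also bring \<open>t\<close>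
  there.\<close>

lemma solvable_beta:
  assumes "solvable s" "closed_trm t" "ctxt_closure beta_contr s t"
  shows "solvable t"
proof -
  from assms(1) obtain us where us: "\<forall>u\<in>set us. closed_trm u"
    "beta_conv (apps s us) (Lam (Var 0))"
    unfolding solvable_def unsolvable_def by blast
  have "beta_conv (apps t us) (apps s us)"
    unfolding beta_conv_def
    by (rule equivclp_sym, rule r_into_equivclp, rule ctxt_closure_apps, fact)
  with us have "beta_conv (apps t us) (Lam (Var 0))"
    unfolding beta_conv_def by (blast intro: equivclp_trans)
  with us(1) assms(2) show ?thesis unfolding solvable_def unsolvable_def by blast
qed

text \<open>Induction along the terminating head reduction. The contraction is at once a weak step,
  which builds the reduction and keeps the term closed; a beta step, which keeps it solvable; and a
  head step, which makes the induction progress.\<close>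

lemma solvable_reaches_whnf:
  assumes "solvable M"
  shows "\<exists>N. whnf N \<and> wbO\<^sup>*\<^sup>* M N"
  using solvable_head_terminating[OF assms] assms
proof (induction M rule: accp.induct)
  case (accI M)
  show ?case
  proof (cases "whnf M")
    case False
    have clM: "closed_trm M" using accI.prems by (simp add: solvable_def)
    with False accI.prems obtain n U V Ms where U: "closed_trm (Lam U)" and V: "closed_trm V"
      and M: "M = (Lam ^^ n) (apps (App (Lam U) V) Ms)"
      unfolding whnf_def by blast
    let ?M' = "(Lam ^^ n) (apps (subst U V 0) Ms)"
    have step: "wbO M ?M'"
      unfolding M wbO_def
      by (intro ctxt_closure_Lams ctxt_closure_apps ctxt_closure.base wbO_contr.wbeta)
        (use U V in \<open>simp add: closed_trm_def\<close>)
    then have "closed_trm ?M'" using clM wbO_free_vars unfolding closed_trm_def by blast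
    moreover have "ctxt_closure beta_contr M ?M'"
      unfolding M
      by (intro ctxt_closure_Lams ctxt_closure_apps ctxt_closure.base beta_contr.intros)
    ultimately have "solvable ?M'" using accI.prems solvable_beta by blast
    moreover have "head_red M ?M'"
      unfolding M by (intro head_red_Lams head_red_apps head_red.beta) simp
    ultimately obtain N where "whnf N" "wbO\<^sup>*\<^sup>* ?M' N" using accI(2) by blast
    with step show ?thesis by (blast intro: converse_rtranclp_into_rtranclp)
  qed blast
qed

theorem theorem7p1:
  fixes M :: trm
  assumes "closed_trm M"
  shows "\<exists>N. closed_trm N \<and> whnf N \<and> wbO\<^sup>*\<^sup>* M N"
proof (cases "unsolvable M")
  case True
  have "wbO\<^sup>*\<^sup>* M Omega"
  \<comment> \<open>The rule \<open>omega\<close> does not apply to \<open>Omega\<close> itself,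
    where the empty reduction serves.\<close>
  proof (cases "M = Omega")
    case False
    with True assms have "wbO M Omega"
      unfolding wbO_def by (intro ctxt_closure.base wbO_contr.omega)
    then show ?thesis ..
  qed simp
  moreover have "whnf Omega"
    using unsolvable_Omega by (simp add: whnf_def unsolvable_def)
  ultimately show ?thesis unfolding whnf_def by blast
next
  case False
  with assms have "solvable M" by (simp add: solvable_def)
  then show ?thesis using solvable_reaches_whnf unfolding whnf_def by blast
qed

end
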